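(* Let $S$ be a finite set and let $\varphi\colon 2^S\to\mathbb{R}$ be a polymatroid function which is $k$-tensor-compatible with the rank function of the uniform matroid $U_{2,3}$ for each positive integer $k$. Then $\varphi$ is fully fractionally modular extendable.
   Context: Ground sets are finite. A polymatroid function is a set function $\varphi\colon 2^S\to\mathbb{R}$ that is increasing ($X\subseteq Y$ implies $\varphi(X)\le\varphi(Y)$), submodular ($\varphi(X)+\varphi(Y)\ge\varphi(X\cap Y)+\varphi(X\cup Y)$) and satisfies $\varphi(\emptyset)=0$. $U_{2,3}$ is the rank-$2$ uniform matroid on three elements; its rank function is $X\mapsto\min\{|X|,2\}$. A tensor product of polymatroid functions $\varphi_1\colon 2^{S_1}\to\mathbb{R}$ and $\varphi_2\colon 2^{S_2}\to\mathbb{R}$ is a polymatroid function $\varphi\colon 2^{S_1\times S_2}\to\mathbb{R}$ (not necessarily integer-valued) with $\varphi(X_1\times X_2)=\varphi_1(X_1)\varphi_2(X_2)$ for all $X_1\subseteq S_1$, $X_2\subseteq S_2$; the set of these is denoted $\varphi_1\otimes\varphi_2$. Let $T_1(\varphi,\psi)=\varphi\otimes\psi$ and $T_k(\varphi,\psi)=\bigcup_{\varphi'\in T_{k-1}(\varphi,\psi)}\varphi'\otimes\psi$ for $k\ge2$. $\varphi$ is $k$-tensor-compatible with $\psi$ if $T_k(\varphi,\psi)\ne\emptyset$. For a polymatroid function $\varphi\colon 2^S\to\mathbb{R}$ and $A,B\subseteq S$, an extension step with respect to $A$ and $B$ results in a polymatroid function $\varphi'\colon 2^{S'}\to\mathbb{R}$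 with $S\subseteq S'$ such that $\varphi'(X)=\varphi(X)$ for all $X\subseteq S$ and there is $Z\subseteq S'$ with $\varphi'(A\cup Z)=\varphi(A)$, $\varphi'(B\cup Z)=\varphi(B)$, $\varphi'(Z)=\varphi(A)+\varphi(B)-\varphi(A\cup B)$. Every polymatroid function is $0$-fractionally modular extendable; for $k\ge1$, $\varphi$ is $k$-fractionally modular extendable if for all $A,B\subseteq S$ there is a $(k-1)$-fractionally modular extendable polymatroid function obtained from $\varphi$ by an extension step with respect to $A$ and $B$. $\varphi$ is fully fractionally modular extendable if it is $k$-fractionally modular extendable for every positive integer $k$. *)

theory Defs
  imports Complex_Main
begin

text \<open>
  A set function on the finite ground set \<open>S\<close> is given by a function on all sets of the
  ambient type; only its values on subsets of \<open>S\<close> are ever used.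
\<close>

definition polymatroid_function :: "'a set \<Rightarrow> ('a set \<Rightarrow> real) \<Rightarrow> bool" where
  "polymatroid_function S \<phi> \<longleftrightarrow>
     finite S \<and>
     (\<forall>X Y. X \<subseteq> Y \<and> Y \<subseteq> S \<longrightarrow> \<phi> X \<le> \<phi> Y) \<and>
     (\<forall>X Y. X \<subseteq> S \<and> Y \<subseteq> S \<longrightarrow> \<phi> X + \<phi> Y \<ge> \<phi> (X \<inter> Y) + \<phi> (X \<union> Y)) \<and>
     \<phi> {} = 0"

definition uniform_ground :: "nat \<Rightarrow> nat set" where
  "uniform_ground n = {..<n}"

definition uniform_rank :: "nat \<Rightarrow> nat set \<Rightarrow> real" where
  "uniform_rank r X = real (min (card X) r)"

definition tensor_products ::
  "'a set \<Rightarrow> ('a set \<Rightarrow> real) \<Rightarrow> 'b set \<Rightarrow> ('b set \<Rightarrow> real) \<Rightarrow> (('a \<times> 'b) set \<Rightarrow> real) set" where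
  "tensor_products S\<^sub>1 \<phi>\<^sub>1 S\<^sub>2 \<phi>\<^sub>2 =
     {\<phi>. polymatroid_function (S\<^sub>1 \<times> S\<^sub>2) \<phi> \<and>
         (\<forall>X\<^sub>1 X\<^sub>2. X\<^sub>1 \<subseteq> S\<^sub>1 \<and> X\<^sub>2 \<subseteq> S\<^sub>2 \<longrightarrow> \<phi> (X\<^sub>1 \<times> X\<^sub>2) = \<phi>\<^sub>1 X\<^sub>1 * \<phi>\<^sub>2 X\<^sub>2)}"

text \<open>
  The ground set \<open>(\<dots>(S \<times> S\<^sub>2) \<times> \<dots>) \<times> S\<^sub>2\<close> of a \<open>k\<close>-fold tensor product would have a type depending
  on \<open>k\<close>. We therefore relabel \<open>((\<dots>(s, y\<^sub>1), \<dots>), y\<^sub>k)\<close> as \<open>(s, [y\<^sub>k, \<dots>, y\<^sub>1])\<close>; the injection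
  \<open>push\<close> performs one such step.
\<close>

definition push :: "('a \<times> 'b list) \<times> 'b \<Rightarrow> 'a \<times> 'b list" where
  "push p = (case p of ((s, ys), y) \<Rightarrow> (s, y # ys))"

primrec iterated_ground :: "nat \<Rightarrow> 'a set \<Rightarrow> 'b set \<Rightarrow> ('a \<times> 'b list) set" where
  "iterated_ground 0 S S\<^sub>2 = S \<times> {[]}"
| "iterated_ground (Suc k) S S\<^sub>2 = push ` (iterated_ground k S S\<^sub>2 \<times> S\<^sub>2)"

text \<open>
  The recursion starts at \<open>k = 0\<close> with the relabelled copy of \<open>\<phi>\<close> itself, so that the case \<open>k = 1\<close>
  gives the tensor products of \<open>\<phi>\<close> and \<open>\<psi>\<close>.
\<close>

primrec iterated_tensor_products ::
  "nat \<Rightarrow> 'a set \<Rightarrow> ('a set \<Rightarrow> real) \<Rightarrow> 'b set \<Rightarrow> ('b set \<Rightarrow> real) \<Rightarrow> (('a \<times> 'b list) set \<Rightarrow> real) set"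
where
  "iterated_tensor_products 0 S \<phi> S\<^sub>2 \<psi> = {\<lambda>X. \<phi> (fst ` X)}"
| "iterated_tensor_products (Suc k) S \<phi> S\<^sub>2 \<psi> =
     (\<Union>\<phi>' \<in> iterated_tensor_products k S \<phi> S\<^sub>2 \<psi>.
        {\<Phi>. (\<lambda>X. \<Phi> (push ` X)) \<in> tensor_products (iterated_ground k S S\<^sub>2) \<phi>' S\<^sub>2 \<psi>})"

definition tensor_compatible ::
  "nat \<Rightarrow> 'a set \<Rightarrow> ('a set \<Rightarrow> real) \<Rightarrow> 'b set \<Rightarrow> ('b set \<Rightarrow> real) \<Rightarrow> bool" where
  "tensor_compatible k S \<phi> S\<^sub>2 \<psi> \<longleftrightarrow> iterated_tensor_products k S \<phi> S\<^sub>2 \<psi> \<noteq> {}"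

definition extension_step ::
  "'a set \<Rightarrow> ('a set \<Rightarrow> real) \<Rightarrow> 'a set \<Rightarrow> 'a set \<Rightarrow> 'a set \<Rightarrow> ('a set \<Rightarrow> real) \<Rightarrow> bool" where
  "extension_step S \<phi> A B S' \<phi>' \<longleftrightarrow>
     polymatroid_function S' \<phi>' \<and> S \<subseteq> S' \<and> (\<forall>X \<subseteq> S. \<phi>' X = \<phi> X) \<and>
     (\<exists>Z \<subseteq> S'. \<phi>' (A \<union> Z) = \<phi> A \<and> \<phi>' (B \<union> Z) = \<phi> B \<and> \<phi>' Z = \<phi> A + \<phi> B - \<phi> (A \<union> B))"

text \<open>
  Extensions must be able to add arbitrarily many new elements, even if the type \<open>'a\<close> of the original
  ground set is finite. They are therefore taken inside \<open>'a + nat\<close>, which contains an isomorphic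
  copy of every finite extension of a finite ground set.
\<close>

primrec frac_mod_extendable_sum ::
  "nat \<Rightarrow> ('a + nat) set \<Rightarrow> (('a + nat) set \<Rightarrow> real) \<Rightarrow> bool" where
  "frac_mod_extendable_sum 0 S \<phi> \<longleftrightarrow> polymatroid_function S \<phi>"
| "frac_mod_extendable_sum (Suc k) S \<phi> \<longleftrightarrow>
     polymatroid_function S \<phi> \<and>
     (\<forall>A B. A \<subseteq> S \<and> B \<subseteq> S \<longrightarrow>
        (\<exists>S' \<phi>'. extension_step S \<phi> A B S' \<phi>' \<and> frac_mod_extendable_sum k S' \<phi>'))"

definition frac_mod_extendable :: "nat \<Rightarrow> 'a set \<Rightarrow> ('a set \<Rightarrow> real) \<Rightarrow> bool" where
  "frac_mod_extendable k S \<phi> \<longleftrightarrow> frac_mod_extendable_sum k (Inl ` S) (\<lambda>X. \<phi> (Inl -` X))"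

definition fully_frac_mod_extendable :: "'a set \<Rightarrow> ('a set \<Rightarrow> real) \<Rightarrow> bool" where
  "fully_frac_mod_extendable S \<phi> \<longleftrightarrow> (\<forall>k \<ge> 1. frac_mod_extendable k S \<phi>)"

end

theory Submission
  imports Defs
begin

text \<open>
  The idea is best seen for a polymatroid that is represented by subspaces of a vector space \<open>V\<close>.
  Its tensor product with \<open>U\<^sub>2\<^sub>,\<^sub>3\<close> lives in \<open>V \<otimes> F\<^sup>2\<close>, where the points \<open>0, 1, 2\<close> of
  \<open>U\<^sub>2\<^sub>,\<^sub>3\<close> are vectors \<open>e\<^sub>0\<close>, \<open>e\<^sub>1\<close> and \<open>e\<^sub>2 = e\<^sub>0 + e\<^sub>1\<close>. The block
  \<open>C = A \<times> {0} \<union> B \<times> {1}\<close> spans \<open>A \<otimes> e\<^sub>0 + B \<otimes> e\<^sub>1\<close>, and this space meets the copy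
  \<open>V \<otimes> e\<^sub>2\<close> of \<open>V\<close> exactly in \<open>(A \<inter> B) \<otimes> e\<^sub>2\<close>. So the tensor product knows the common part of
  \<open>A\<close> and \<open>B\<close>, and for \<open>\<Phi> \<in> \<phi> \<otimes> U\<^sub>2\<^sub>,\<^sub>3\<close> the formula
  \<open>\<phi>' (X \<union> {z}) = \<Phi> (X \<times> {2} \<union> C) - \<phi> (A \<union> B)\<close> defines an extension step. The values needed
  to see this (\<open>tensor_layers_modular\<close>, \<open>tensor_two_blocks\<close>, \<open>tensor_full_layer_gap\<close>) follow from
  submodularity and from the values of \<open>\<Phi>\<close> on products.

  To iterate, one would like \<open>\<phi>'\<close> to be tensor-compatible again, but there is no evident
  tensor product of \<open>\<phi>'\<close>: the blocks \<open>C \<times> J\<close> in a higher tensor product would have to be cut down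
  compatibly for all \<open>J\<close> at once. Instead, the induction is on extendability itself. Since \<open>\<Phi>\<close> is
  \<open>k\<close>-tensor-compatible if \<open>\<phi>\<close> is \<open>(k + 1)\<close>-tensor-compatible with \<open>\<Phi>\<close> as its first stage, the
  induction hypothesis makes \<open>\<Phi>\<close> \<open>k\<close>-fractionally modular extendable, and it is enough that \<open>\<phi>'\<close>
  inherits this from \<open>\<Phi>\<close>.

  That inheritance is \<open>frac_mod_extendable_block_reduct\<close>. Suppose that \<open>f\<close> arises from \<open>g\<close> by
  replacing elements by blocks and then lowering by a constant \<open>d\<close> the values of the sets that
  contain one of certain marked elements, whose blocks all contain a fixed set \<open>C\<close>. An extension
  step for \<open>f\<close> is then obtained from the corresponding step for \<open>g\<close>: the new element receives the new
  set \<open>Z\<close> as its block, and it is marked exactly if \<open>A\<close> and \<open>B\<close> both contain a marked element. In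
  that case \<open>C\<close> lies below both, hence is spanned by \<open>Z\<close>, and \<open>Z \<union> C\<close> can serve as the block.
\<close>

section \<open>Polymatroid functions\<close>

lemma polymatroid_functionD:
  assumes "polymatroid_function S f"
  shows polymatroid_finite: "finite S"
    and polymatroid_mono: "X \<subseteq> Y \<Longrightarrow> Y \<subseteq> S \<Longrightarrow> f X \<le> f Y"
    and polymatroid_submodular:
      "X \<subseteq> S \<Longrightarrow> Y \<subseteq> S \<Longrightarrow> f (X \<inter> Y) + f (X \<union> Y) \<le> f X + f Y"
    and polymatroid_empty: "f {} = 0"
  using assms by (auto simp: polymatroid_function_def)

lemma polymatroid_marginal_antimono:
  assumes "polymatroid_function S f" "X \<subseteq> Y" "Y \<subseteq> S" "Q \<subseteq> S"
  shows "f (Y \<union> Q) - f Y \<le> f (X \<union> Q) - f X"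
proof -
  have "f ((X \<union> Q) \<inter> Y) + f ((X \<union> Q) \<union> Y) \<le> f (X \<union> Q) + f Y"
    using assms by (intro polymatroid_submodular[OF assms(1)]) auto
  moreover have "f X \<le> f ((X \<union> Q) \<inter> Y)"
    using assms by (intro polymatroid_mono[OF assms(1)]) auto
  moreover have "(X \<union> Q) \<union> Y = Y \<union> Q" using assms by auto
  ultimately show ?thesis by simp
qed

lemma polymatroid_spanned_mono:
  assumes "polymatroid_function S f" "X \<subseteq> Y" "Y \<subseteq> S" "Q \<subseteq> S" "f (X \<union> Q) = f X"
  shows "f (Y \<union> Q) = f Y"
proof (rule antisym)
  show "f (Y \<union> Q) \<le> f Y"
    using polymatroid_marginal_antimono[OF assms(1-4)] assms(5) by simp
  show "f Y \<le> f (Y \<union> Q)"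
    using assms by (intro polymatroid_mono[OF assms(1)]) auto
qed

lemma polymatroid_image:
  assumes "polymatroid_function S (\<lambda>X. f (h ` X))" "inj h"
  shows "polymatroid_function (h ` S) f"
  unfolding polymatroid_function_def
proof (intro conjI allI impI)
  show "finite (h ` S)" using polymatroid_finite[OF assms(1)] by simp
next
  fix X Y assume *: "X \<subseteq> Y \<and> Y \<subseteq> h ` S"
  then obtain X' Y' where "Y' \<subseteq> S" "Y = h ` Y'" "X = h ` X'"
    by (metis order_trans subset_imageE)
  with * show "f X \<le> f Y"
    using polymatroid_mono[OF assms(1), of X' Y'] assms(2) by (simp add: inj_image_subset_iff)
next
  fix X Y assume *: "X \<subseteq> h ` S \<and> Y \<subseteq> h ` S"
  then obtain X' Y' where "X' \<subseteq> S" "Y' \<subseteq> S" "Y = h ` Y'" "X = h ` X'"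
    by (metis subset_imageE)
  then show "f (X \<inter> Y) + f (X \<union> Y) \<le> f X + f Y"
    using polymatroid_submodular[OF assms(1), of X' Y'] assms(2)
    by (simp add: image_Un image_Int)
next
  show "f {} = 0" using polymatroid_empty[OF assms(1)] by simp
qed

text \<open>
  The set \<open>Z\<close> of an extension step attains this bound. It is therefore a maximal common part of \<open>A\<close>
  and \<open>B\<close>, and it spans everything else that lies below both.
\<close>

lemma common_information_upper_bound:
  assumes "polymatroid_function S f" "A \<subseteq> S" "B \<subseteq> S" "Z \<subseteq> S"
    and "f (A \<union> Z) = f A" "f (B \<union> Z) = f B"
  shows "f Z \<le> f A + f B - f (A \<union> B)"
proof -
  have "f ((A \<union> Z) \<inter> (B \<union> Z)) + f ((A \<union> Z) \<union> (B \<union> Z)) \<le> f (A \<union> Z) + f (B \<union> Z)"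
    using assms by (intro polymatroid_submodular[OF assms(1)]) auto
  moreover have "f Z \<le> f ((A \<union> Z) \<inter> (B \<union> Z))" "f (A \<union> B) \<le> f ((A \<union> Z) \<union> (B \<union> Z))"
    using assms by (auto intro!: polymatroid_mono[OF assms(1)])
  ultimately show ?thesis using assms by simp
qed

section \<open>Cutting blocks down along a common part\<close>

text \<open>
  In the representable picture, \<open>T\<close> consists of elements whose blocks are to be replaced by their
  intersections with the span of the remaining blocks. If each block of \<open>T\<close> exceeds that span by the
  same dimension \<open>d\<close>, and in the same directions, then this lowers the rank of every set that meets
  \<open>T\<close> by exactly \<open>d\<close>.
\<close>

definition block_reduct ::
  "('u set \<Rightarrow> real) \<Rightarrow> ('e \<Rightarrow> 'u set) \<Rightarrow> 'e set \<Rightarrow> real \<Rightarrow> 'e set \<Rightarrow> real" where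
  "block_reduct g \<beta> T d X = g (\<Union> (\<beta> ` X)) - (if X \<inter> T = {} then 0 else d)"

text \<open>
  The set \<open>C\<close> accounts for the common directions: it lies in every block of \<open>T\<close>, and even over all
  the other blocks together it still contributes at least \<open>d\<close>.
\<close>

definition reducible ::
  "'u set \<Rightarrow> ('u set \<Rightarrow> real) \<Rightarrow> 'e set \<Rightarrow> ('e \<Rightarrow> 'u set) \<Rightarrow> 'e set \<Rightarrow> 'u set \<Rightarrow> real \<Rightarrow> bool" where
  "reducible U g E \<beta> T C d \<longleftrightarrow>
     finite E \<and> C \<subseteq> U \<and> (\<forall>e\<in>E. \<beta> e \<subseteq> U) \<and> (\<forall>t\<in>T. C \<subseteq> \<beta> t) \<and>
     d \<le> g (\<Union> (\<beta> ` (E - T)) \<union> C) - g (\<Union> (\<beta> ` (E - T)))"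

text \<open>
  The correction term violates submodularity only if \<open>X\<close> and \<open>Y\<close> both meet \<open>T\<close> but \<open>X \<inter> Y\<close> does
  not. Then \<open>C\<close> lies in the intersection of the two unions of blocks although it is not counted in
  \<open>X \<inter> Y\<close>, and its contribution compensates for the missing \<open>d\<close>.
\<close>

lemma polymatroid_block_reduct:
  assumes g: "polymatroid_function U g" and r: "reducible U g E \<beta> T C d"
    and eq: "\<And>X. X \<subseteq> E \<Longrightarrow> f X = block_reduct g \<beta> T d X"
  shows "polymatroid_function E f"
proof -
  let ?b = "\<lambda>X. \<Union> (\<beta> ` X)"
  note mono = polymatroid_mono[OF g] and submod = polymatroid_submodular[OF g]
  have fin: "finite E" and CU: "C \<subseteq> U" and bU: "\<And>X. X \<subseteq> E \<Longrightarrow> ?b X \<subseteq> U"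
    and CT: "\<And>t. t \<in> T \<Longrightarrow> C \<subseteq> \<beta> t"
    and gap: "d \<le> g (?b (E - T) \<union> C) - g (?b (E - T))"
    using r by (auto simp: reducible_def)
  have hit: "C \<subseteq> ?b X" if "X \<inter> T \<noteq> {}" for X
    using CT that by blast
  have loss: "g (?b X) + d \<le> g (?b X \<union> C)" if "X \<subseteq> E" "X \<inter> T = {}" for X
  proof -
    have "g (?b (E - T) \<union> C) - g (?b (E - T)) \<le> g (?b X \<union> C) - g (?b X)"
      using that bU[of "E - T"] CU by (intro polymatroid_marginal_antimono[OF g]) auto
    with gap show ?thesis by simp
  qed
  show ?thesis
    unfolding polymatroid_function_def
  proof (intro conjI allI impI)
    show "finite E" by (fact fin)
    show "f {} = 0" using polymatroid_empty[OF g] eq[of "{}"] by (simp add: block_reduct_def)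
  next
    fix X Y assume XY: "X \<subseteq> Y \<and> Y \<subseteq> E"
    then have XE: "X \<subseteq> E" and YE: "Y \<subseteq> E" by auto
    have le: "g (?b X) \<le> g (?b Y)" using XY bU[OF YE] by (intro mono) auto
    show "f X \<le> f Y"
    proof (cases "X \<inter> T = {} \<and> Y \<inter> T \<noteq> {}")
      case True
      have "g (?b X \<union> C) \<le> g (?b Y)"
        using XY bU[OF YE] hit[of Y] True by (intro mono) auto
      with loss[OF XE] True show ?thesis by (simp add: eq XE YE block_reduct_def)
    next
      case False
      moreover have "X \<inter> T \<noteq> {} \<Longrightarrow> Y \<inter> T \<noteq> {}" using XY by auto
      ultimately show ?thesis using le by (auto simp: eq XE YE block_reduct_def)
    qed
  next
    fix X Y assume "X \<subseteq> E \<and> Y \<subseteq> E"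
    then have XE: "X \<subseteq> E" and YE: "Y \<subseteq> E" and UE: "X \<union> Y \<subseteq> E" and IE: "X \<inter> Y \<subseteq> E" by auto
    have sub: "g (?b X \<inter> ?b Y) + g (?b (X \<union> Y)) \<le> g (?b X) + g (?b Y)"
      using submod[OF bU[OF XE] bU[OF YE]] by simp
    have capU: "?b X \<inter> ?b Y \<subseteq> U" using bU[OF XE] by auto
    have cap: "g (?b (X \<inter> Y)) \<le> g (?b X \<inter> ?b Y)"
      using capU by (intro mono) auto
    show "f (X \<inter> Y) + f (X \<union> Y) \<le> f X + f Y"
    proof (cases "X \<inter> T \<noteq> {} \<and> Y \<inter> T \<noteq> {} \<and> X \<inter> Y \<inter> T = {}")
      case True
      have "g (?b (X \<inter> Y) \<union> C) \<le> g (?b X \<inter> ?b Y)"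
        using capU hit[of X] hit[of Y] True by (intro mono) auto
      moreover have "(X \<union> Y) \<inter> T \<noteq> {}" using True by auto
      ultimately show ?thesis
        using loss[OF IE] sub True by (simp add: eq XE YE UE IE block_reduct_def)
    next
      case False
      have "(if X \<inter> T = {} then 0 else d) + (if Y \<inter> T = {} then 0 else d) =
        (if X \<inter> Y \<inter> T = {} then 0 else d) + (if (X \<union> Y) \<inter> T = {} then 0 else d)"
        using False by auto
      then show ?thesis using sub cap
        by (simp only: eq XE YE UE IE block_reduct_def)
    qed
  qed
qed

lemma frac_mod_extendable_sum_polymatroid:
  "frac_mod_extendable_sum k S f \<Longrightarrow> polymatroid_function S f"
  by (cases k) auto

text \<open>
  Extendability of \<open>g\<close> passes to \<open>f\<close> because the shape of the reduction survives an extension step.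
  Marking the new element \<open>z\<close> when \<open>A\<close> and \<open>B\<close> both meet \<open>T\<close> makes its value right in all cases,
  since the numbers of corrections of \<open>A\<close> and \<open>B\<close> and of \<open>A \<union> B\<close> differ by one exactly then. In the
  other cases \<open>Z\<close> is spanned by the blocks of whichever of \<open>A\<close>, \<open>B\<close> avoids \<open>T\<close>, so the contribution
  of \<open>C\<close> over the unmarked blocks is unchanged. The two ground types are independent, which lets the
  lemma also serve to move between differently labelled ground sets.
\<close>

lemma frac_mod_extendable_block_reduct:
  fixes g :: "('u + nat) set \<Rightarrow> real" and f :: "('e + nat) set \<Rightarrow> real"
  assumes "frac_mod_extendable_sum k U g" "reducible U g E \<beta> T C d"
    and "\<And>X. X \<subseteq> E \<Longrightarrow> f X = block_reduct g \<beta> T d X"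
  shows "frac_mod_extendable_sum k E f"
  using assms
proof (induction k arbitrary: U g E \<beta> T f)
  case 0
  then show ?case using polymatroid_block_reduct[OF _ 0(2,3)] by simp
next
  case (Suc k)
  let ?b = "\<lambda>X. \<Union> (\<beta> ` X)"
  have g: "polymatroid_function U g"
    using Suc.prems(1) by simp
  have fin: "finite E" and CU: "C \<subseteq> U" and bU: "\<And>X. X \<subseteq> E \<Longrightarrow> ?b X \<subseteq> U"
    and CT: "\<And>t. t \<in> T \<Longrightarrow> C \<subseteq> \<beta> t"
    and gap: "d \<le> g (?b (E - T) \<union> C) - g (?b (E - T))"
    using Suc.prems(2) by (auto simp: reducible_def)
  have f: "polymatroid_function E f"
    using polymatroid_block_reduct[OF g Suc.prems(2,3)] .
  moreover have "\<exists>E' f'. extension_step E f A B E' f' \<and> frac_mod_extendable_sum k E' f'"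
    if AE: "A \<subseteq> E" and BE: "B \<subseteq> E" for A B
  proof -
    note AU = bU[OF AE] and BU = bU[OF BE]
    obtain U' h where step: "extension_step U g (?b A) (?b B) U' h"
      and ext: "frac_mod_extendable_sum k U' h"
      using Suc.prems(1)[unfolded frac_mod_extendable_sum.simps] AU BU by meson
    from step obtain Z where h: "polymatroid_function U' h" and UU: "U \<subseteq> U'"
      and hg: "\<And>X. X \<subseteq> U \<Longrightarrow> h X = g X" and ZU: "Z \<subseteq> U'"
      and ZA: "h (?b A \<union> Z) = g (?b A)" and ZB: "h (?b B \<union> Z) = g (?b B)"
      and Z: "h Z = g (?b A) + g (?b B) - g (?b A \<union> ?b B)"
      unfolding extension_step_def by blast
    have ZA': "h (?b A \<union> Z) = h (?b A)" and ZB': "h (?b B \<union> Z) = h (?b B)"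
      using ZA ZB hg AU BU by simp_all
    have "infinite (UNIV :: ('e + nat) set)" by (simp add: finite_Plus_UNIV_iff)
    then have "\<exists>z. z \<notin> E" using fin by (rule ex_new_if_finite)
    then obtain z where zE: "z \<notin> E" by blast
    define both where "both \<longleftrightarrow> A \<inter> T \<noteq> {} \<and> B \<inter> T \<noteq> {}"
    define Z' where "Z' = (if both then Z \<union> C else Z)"
    define T' where "T' = (if both then insert z (T \<inter> E) else T \<inter> E)"
    define \<beta>' where "\<beta>' = \<beta>(z := Z')"
    define f' where "f' = block_reduct h \<beta>' T' d"
    let ?b' = "\<lambda>X. \<Union> (\<beta>' ` X)"
    have b'old: "?b' X = ?b X" if "X \<subseteq> E" for X
      using that zE by (auto simp: \<beta>'_def)
    have b'new: "?b' (X \<union> {z}) = ?b X \<union> Z'" if "X \<subseteq> E" for X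
      using that zE by (auto simp: \<beta>'_def)
    have Cboth: "C \<subseteq> ?b A" "C \<subseteq> ?b B" if both
      using CT that by (auto simp: both_def)
    have Z'U: "Z' \<subseteq> U'" using ZU CU UU by (auto simp: Z'_def)
    have Z'A: "h (?b A \<union> Z') = h (?b A)"
    proof -
      have "both \<Longrightarrow> ?b A \<union> (Z \<union> C) = ?b A \<union> Z" using Cboth by blast
      then show ?thesis using ZA' by (auto simp: Z'_def)
    qed
    have Z'B: "h (?b B \<union> Z') = h (?b B)"
    proof -
      have "both \<Longrightarrow> ?b B \<union> (Z \<union> C) = ?b B \<union> Z" using Cboth by blast
      then show ?thesis using ZB' by (auto simp: Z'_def)
    qed
    have AU': "?b A \<subseteq> U'" and BU': "?b B \<subseteq> U'" using AU BU UU by auto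
    have hAB: "h (?b A \<union> ?b B) = g (?b A \<union> ?b B)" using hg AU BU by simp
    \<comment> \<open>If both sets are marked, then \<open>C\<close> lies below both, so maximality of \<open>Z\<close> as a common part
      shows that adding \<open>C\<close> to \<open>Z\<close> does not raise its rank.\<close>
    have Z'Z: "h Z' = h Z"
    proof (rule antisym)
      show "h Z' \<le> h Z"
        using common_information_upper_bound[OF h AU' BU' Z'U Z'A Z'B] hAB hg AU BU Z by simp
      show "h Z \<le> h Z'"
        using Z'U by (intro polymatroid_mono[OF h]) (auto simp: Z'_def)
    qed
    have gap': "d \<le> h (?b' (insert z E - T') \<union> C) - h (?b' (insert z E - T'))"
    proof (cases both)
      case True
      then have "insert z E - T' = E - T" using zE by (auto simp: T'_def)
      moreover have "?b (E - T) \<union> C \<subseteq> U" using bU[of "E - T"] CU by auto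
      ultimately show ?thesis
        using gap hg b'old[of "E - T"] by simp
    next
      case False
      let ?R = "?b (E - T)"
      have RU: "?R \<subseteq> U" using bU[of "E - T"] by auto
      then have RU': "?R \<subseteq> U'" and RCU': "?R \<union> C \<subseteq> U'" using UU CU by auto
      have spanned: "h (?R \<union> Z) = h ?R" "h (?R \<union> C \<union> Z) = h (?R \<union> C)"
      proof -
        have "?b A \<subseteq> ?R \<or> ?b B \<subseteq> ?R"
          using False AE BE unfolding both_def by blast
        then show "h (?R \<union> Z) = h ?R" "h (?R \<union> C \<union> Z) = h (?R \<union> C)"
          using polymatroid_spanned_mono[OF h _ RU' ZU ZA'] polymatroid_spanned_mono[OF h _ RU' ZU ZB']
            polymatroid_spanned_mono[OF h _ RCU' ZU ZA'] polymatroid_spanned_mono[OF h _ RCU' ZU ZB']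
          by blast+
      qed
      have "insert z E - T' = (E - T) \<union> {z}" using False zE by (auto simp: T'_def)
      then have "?b' (insert z E - T') = ?R \<union> Z"
        using b'new[of "E - T"] False by (simp add: Z'_def)
      moreover have "?R \<union> Z \<union> C = ?R \<union> C \<union> Z" by blast
      ultimately show ?thesis
        using gap spanned hg RU CU by simp
    qed
    have "reducible U' h (insert z E) \<beta>' T' C d"
      unfolding reducible_def
    proof (intro conjI ballI)
      show "finite (insert z E)" using fin by simp
      show "C \<subseteq> U'" using CU UU by simp
      show "\<beta>' e \<subseteq> U'" if "e \<in> insert z E" for e
        using that Z'U bU[of E] UU by (auto simp: \<beta>'_def)
      show "C \<subseteq> \<beta>' t" if "t \<in> T'" for t
        using that CT zE by (auto simp: \<beta>'_def T'_def Z'_def split: if_splits)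
      show "d \<le> h (?b' (insert z E - T') \<union> C) - h (?b' (insert z E - T'))" by (fact gap')
    qed
    then have ext': "frac_mod_extendable_sum k (insert z E) f'"
      using Suc.IH[OF ext, of "insert z E" \<beta>' T' f'] by (simp add: f'_def)
    have T'old: "X \<inter> T' = {} \<longleftrightarrow> X \<inter> T = {}" if "X \<subseteq> E" for X
      using that zE by (auto simp: T'_def)
    have f'old: "f' X = f X" if "X \<subseteq> E" for X
      using that Suc.prems(3)[OF that] b'old[OF that] T'old[OF that] hg[OF bU[OF that]]
      by (simp add: f'_def block_reduct_def)
    have f'A: "f' (A \<union> {z}) = f A"
    proof -
      have "(A \<union> {z}) \<inter> T' = {} \<longleftrightarrow> A \<inter> T = {}"
        using AE zE by (auto simp: T'_def both_def)
      then show ?thesis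
        using Z'A b'new[OF AE] Suc.prems(3)[OF AE] hg[OF AU] by (simp add: f'_def block_reduct_def)
    qed
    have f'B: "f' (B \<union> {z}) = f B"
    proof -
      have "(B \<union> {z}) \<inter> T' = {} \<longleftrightarrow> B \<inter> T = {}"
        using BE zE by (auto simp: T'_def both_def)
      then show ?thesis
        using Z'B b'new[OF BE] Suc.prems(3)[OF BE] hg[OF BU] by (simp add: f'_def block_reduct_def)
    qed
    have f'z: "f' {z} = f A + f B - f (A \<union> B)"
    proof -
      have zT: "{z} \<inter> T' = {} \<longleftrightarrow> \<not> both" using zE by (auto simp: T'_def)
      have bz: "?b' {z} = Z'" by (simp add: \<beta>'_def)
      have bAB: "?b (A \<union> B) = ?b A \<union> ?b B" by simp
      have "A \<union> B \<subseteq> E" using AE BE by simp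
      note eqs = Suc.prems(3)[OF AE] Suc.prems(3)[OF BE] Suc.prems(3)[OF this]
      have "f' {z} = g (?b A) + g (?b B) - g (?b A \<union> ?b B) - (if both then d else 0)"
        unfolding f'_def block_reduct_def zT bz Z'Z Z by simp
      also have "\<dots> = f A + f B - f (A \<union> B)"
        unfolding eqs block_reduct_def bAB by (auto simp: both_def)
      finally show ?thesis .
    qed
    have "extension_step E f A B (insert z E) f'"
      unfolding extension_step_def
      using frac_mod_extendable_sum_polymatroid[OF ext'] f'old f'A f'B f'z
      by (auto intro!: exI[of _ "{z}"])
    with ext' show ?thesis by blast
  qed
  ultimately show ?case by simp
qed

section \<open>Tensor products with the three-point line\<close>

context
  fixes G :: "'g set" and f :: "'g set \<Rightarrow> real" and \<Phi> :: "('g \<times> nat) set \<Rightarrow> real"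
  assumes tensor: "\<Phi> \<in> tensor_products G f (uniform_ground 3) (uniform_rank 2)"
begin

lemma tensor_polymatroid: "polymatroid_function (G \<times> {..<3}) \<Phi>"
  using tensor by (simp add: tensor_products_def uniform_ground_def)

lemma tensor_line:
  assumes "X \<subseteq> G" "J \<subseteq> {..<3}"
  shows "\<Phi> (X \<times> J) = f X * real (min (card J) 2)"
  using tensor assms by (simp add: tensor_products_def uniform_ground_def uniform_rank_def)

lemma tensor_layer:
  assumes "X \<subseteq> G" "i < 3"
  shows "\<Phi> (X \<times> {i}) = f X"
  using tensor_line[of X "{i}"] assms by simp

lemma tensor_factor_polymatroid: "polymatroid_function G f"
proof -
  note p = tensor_polymatroid
  have layer: "f X = \<Phi> (X \<times> {0})" if "X \<subseteq> G" for X
    using tensor_layer[OF that, of 0] by simp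
  have fin: "finite G"
    using finite_cartesian_productD1[OF polymatroid_finite[OF p]] by (simp add: lessThan_empty_iff)
  show ?thesis
    unfolding polymatroid_function_def
  proof (intro conjI allI impI)
    fix X Y assume XY: "X \<subseteq> Y \<and> Y \<subseteq> G"
    then have "\<Phi> (X \<times> {0}) \<le> \<Phi> (Y \<times> {0})" by (intro polymatroid_mono[OF p]) auto
    with XY show "f X \<le> f Y" using layer[of X] layer[of Y] by auto
  next
    fix X Y assume XY: "X \<subseteq> G \<and> Y \<subseteq> G"
    then have "\<Phi> (X \<times> {0} \<inter> Y \<times> {0}) + \<Phi> (X \<times> {0} \<union> Y \<times> {0}) \<le> \<Phi> (X \<times> {0}) + \<Phi> (Y \<times> {0})"
      by (intro polymatroid_submodular[OF p]) auto
    moreover have "X \<times> {0::nat} \<inter> Y \<times> {0} = (X \<inter> Y) \<times> {0}" "X \<times> {0::nat} \<union> Y \<times> {0} = (X \<union> Y) \<times> {0}"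
      by auto
    moreover have "X \<inter> Y \<subseteq> G" "X \<union> Y \<subseteq> G" using XY by auto
    ultimately show "f (X \<inter> Y) + f (X \<union> Y) \<le> f X + f Y"
      using layer XY by metis
  next
    show "f {} = 0" using layer[of "{}"] polymatroid_empty[OF p] by simp
  qed (fact fin)
qed

text \<open>
  On full layers modularity is the value \<open>2 * f G\<close> of two layers. It passes to smaller sets, first in
  layer \<open>j\<close> and then in layer \<open>i\<close>, because marginals can only grow when the set they are taken over
  shrinks.
\<close>

lemma tensor_layers_modular:
  assumes "X \<subseteq> G" "Y \<subseteq> G" "i < 3" "j < 3" "i \<noteq> j"
  shows "\<Phi> (X \<times> {i} \<union> Y \<times> {j}) = f X + f Y"
proof (rule antisym)
  note p = tensor_polymatroid
  have disj: "X \<times> {i} \<inter> Y \<times> {j} = {}" using assms by auto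
  have "\<Phi> (X \<times> {i} \<inter> Y \<times> {j}) + \<Phi> (X \<times> {i} \<union> Y \<times> {j}) \<le> \<Phi> (X \<times> {i}) + \<Phi> (Y \<times> {j})"
    using assms by (intro polymatroid_submodular[OF p]) auto
  then show "\<Phi> (X \<times> {i} \<union> Y \<times> {j}) \<le> f X + f Y"
    unfolding disj using assms by (simp add: tensor_layer polymatroid_empty[OF p])
  have full: "\<Phi> (G \<times> {i} \<union> G \<times> {j}) = 2 * f G"
  proof -
    have "G \<times> {i} \<union> G \<times> {j} = G \<times> {i, j}" by auto
    then show ?thesis using assms tensor_line[of G "{i, j}"] by simp
  qed
  have "\<Phi> (G \<times> {i} \<union> Y \<times> {j} \<union> G \<times> {j}) - \<Phi> (G \<times> {i} \<union> Y \<times> {j}) \<le>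
        \<Phi> (Y \<times> {j} \<union> G \<times> {j}) - \<Phi> (Y \<times> {j})"
    using assms by (intro polymatroid_marginal_antimono[OF p]) auto
  moreover have "Y \<times> {j} \<union> G \<times> {j} = G \<times> {j}" using assms by auto
  moreover from this have "G \<times> {i} \<union> Y \<times> {j} \<union> G \<times> {j} = G \<times> {i} \<union> G \<times> {j}" by (simp add: Un_assoc)
  ultimately have Y: "f G + f Y \<le> \<Phi> (G \<times> {i} \<union> Y \<times> {j})"
    using full assms by (simp add: tensor_layer)
  have "\<Phi> (X \<times> {i} \<union> Y \<times> {j} \<union> G \<times> {i}) - \<Phi> (X \<times> {i} \<union> Y \<times> {j}) \<le>
        \<Phi> (X \<times> {i} \<union> G \<times> {i}) - \<Phi> (X \<times> {i})"
    using assms by (intro polymatroid_marginal_antimono[OF p]) auto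
  moreover have "X \<times> {i} \<union> G \<times> {i} = G \<times> {i}" "X \<times> {i} \<union> Y \<times> {j} \<union> G \<times> {i} = G \<times> {i} \<union> Y \<times> {j}"
    using assms by auto
  ultimately show "f X + f Y \<le> \<Phi> (X \<times> {i} \<union> Y \<times> {j})"
    using Y assms by (simp add: tensor_layer)
qed

text \<open>Two points of the line \<open>U\<^sub>2\<^sub>,\<^sub>3\<close> span the third.\<close>

lemma tensor_third_layer_spanned:
  assumes "X \<times> {i, j} \<subseteq> R" "R \<subseteq> G \<times> {..<3}" "X \<subseteq> G"
    and "i < 3" "j < 3" "i \<noteq> j" "l < 3"
  shows "\<Phi> (R \<union> X \<times> {l}) = \<Phi> R"
proof (rule polymatroid_spanned_mono[OF tensor_polymatroid assms(1,2)])
  show "X \<times> {l} \<subseteq> G \<times> {..<3}" using assms by auto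
  have "X \<times> {i, j} \<union> X \<times> {l} = X \<times> {i, j, l}" by auto
  moreover have "min (card {i, j, l}) 2 = min (card {i, j}) 2"
    using assms(6) by (simp add: card_insert_if)
  ultimately show "\<Phi> (X \<times> {i, j} \<union> X \<times> {l}) = \<Phi> (X \<times> {i, j})"
    using assms(3-5,7) tensor_line[of X "{i, j}"] tensor_line[of X "{i, j, l}"] by simp
qed

text \<open>
  The layers \<open>l\<close> and \<open>i\<close> of \<open>A\<close> span its layer \<open>j\<close>, after which layer \<open>l\<close> is spanned by the rest and
  two modular layers remain. Applied to \<open>A\<close> and, with \<open>i\<close> and \<open>j\<close> exchanged, to \<open>B\<close>, this says that
  the common part of \<open>A\<close> and \<open>B\<close> lies below each of them.
\<close>

lemma tensor_two_blocks:
  assumes "A \<subseteq> G" "B \<subseteq> G" "i < 3" "j < 3" "l < 3" "i \<noteq> j" "i \<noteq> l" "j \<noteq> l"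
  shows "\<Phi> (A \<times> {l} \<union> A \<times> {i} \<union> B \<times> {j}) = f A + f (A \<union> B)"
proof -
  have "\<Phi> (A \<times> {l} \<union> A \<times> {i} \<union> B \<times> {j}) = \<Phi> (A \<times> {l} \<union> A \<times> {i} \<union> B \<times> {j} \<union> A \<times> {j})"
    using assms by (intro tensor_third_layer_spanned[of A l i, symmetric]) auto
  also have "A \<times> {l} \<union> A \<times> {i} \<union> B \<times> {j} \<union> A \<times> {j} = (A \<times> {i} \<union> (A \<union> B) \<times> {j}) \<union> A \<times> {l}"
    by auto
  also have "\<Phi> \<dots> = \<Phi> (A \<times> {i} \<union> (A \<union> B) \<times> {j})"
    using assms by (intro tensor_third_layer_spanned[of A i j]) auto
  also have "\<dots> = f A + f (A \<union> B)"
    using assms by (intro tensor_layers_modular) auto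
  finally show ?thesis .
qed

text \<open>
  Modulo the full layer \<open>l\<close> the other two layers are identified, so that \<open>A \<times> {i} \<union> B \<times> {j}\<close> becomes
  a copy of \<open>A \<union> B\<close>.
\<close>

lemma tensor_full_layer_gap:
  assumes "A \<subseteq> G" "B \<subseteq> G" "i < 3" "j < 3" "l < 3" "i \<noteq> j" "i \<noteq> l" "j \<noteq> l"
  shows "f G + f (A \<union> B) \<le> \<Phi> (G \<times> {l} \<union> (A \<times> {i} \<union> B \<times> {j}))"
proof -
  let ?R = "G \<times> {l} \<union> (A \<times> {i} \<union> B \<times> {j})"
  have "f G + f (A \<union> B) = \<Phi> (G \<times> {l} \<union> (A \<union> B) \<times> {i})"
    using assms by (intro sym[OF tensor_layers_modular]) auto
  also have "\<dots> \<le> \<Phi> (?R \<union> B \<times> {i})"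
    using assms by (intro polymatroid_mono[OF tensor_polymatroid]) auto
  also have "\<dots> = \<Phi> ?R"
    using assms by (intro tensor_third_layer_spanned[of B l j]) auto
  finally show ?thesis .
qed

end

section \<open>Climbing down a tower of tensor products\<close>

lemma inj_push: "inj push"
  by (auto simp: inj_def push_def split: prod.splits)

text \<open>
  The elements of \<open>G\<close> are realised in layer \<open>2\<close>, and the new element by the block that meets this
  layer in the common part of \<open>A\<close> and \<open>B\<close>. Over the full layer \<open>2\<close> this block contributes
  \<open>f (A \<union> B)\<close>, which is the amount \<open>d\<close> by which it is cut down.
\<close>

lemma frac_mod_extendable_if_tensor_product:
  fixes G :: "('a \<times> nat list) set"
  assumes tensor: "(\<lambda>X. \<Psi> (push ` X)) \<in> tensor_products G f (uniform_ground 3) (uniform_rank 2)"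
    and ext: "frac_mod_extendable k (push ` (G \<times> uniform_ground 3)) \<Psi>"
  shows "frac_mod_extendable (Suc k) G f"
proof -
  let ?\<Phi> = "\<lambda>X. \<Psi> (push ` X)"
  define \<iota> where "\<iota> = (Inl \<circ> push :: _ \<Rightarrow> ('a \<times> nat list) + nat)"
  define g where "g = (\<lambda>X :: (('a \<times> nat list) + nat) set. \<Psi> (Inl -` X))"
  have gi: "g (\<iota> ` X) = ?\<Phi> X" for X
    unfolding g_def \<iota>_def image_comp[symmetric] by (simp add: inj_vimage_image_eq)
  have g: "frac_mod_extendable_sum k (\<iota> ` (G \<times> {..<3})) g"
    using ext by (simp add: frac_mod_extendable_def g_def \<iota>_def uniform_ground_def image_comp)
  note fG = tensor_factor_polymatroid[OF tensor]
  let ?f = "\<lambda>X :: (('a \<times> nat list) + nat) set. f (Inl -` X)"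
  have fG': "polymatroid_function (Inl ` G) ?f"
    by (rule polymatroid_image) (simp_all add: inj_vimage_image_eq fG)
  have "\<exists>E' f'. extension_step (Inl ` G) ?f A B E' f' \<and> frac_mod_extendable_sum k E' f'"
    if AG: "A \<subseteq> Inl ` G" and BG: "B \<subseteq> Inl ` G" for A B :: "(('a \<times> nat list) + nat) set"
  proof -
    obtain A0 where A: "A = Inl ` A0" "A0 \<subseteq> G" using AG by (meson subset_imageE)
    obtain B0 where B: "B = Inl ` B0" "B0 \<subseteq> G" using BG by (meson subset_imageE)
    define C where "C = A0 \<times> {0::nat} \<union> B0 \<times> {1}"
    define z :: "('a \<times> nat list) + nat" where "z = Inr 0"
    define \<beta> :: "('a \<times> nat list) + nat \<Rightarrow> (('a \<times> nat list) + nat) set"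
      where "\<beta> = case_sum (\<lambda>x. {\<iota> (x, 2)}) (\<lambda>_. \<iota> ` C)"
    define d where "d = f (A0 \<union> B0)"
    define f' where "f' = block_reduct g \<beta> {z} d"
    have b: "\<Union> (\<beta> ` Inl ` X) = \<iota> ` (X \<times> {2})" for X
      by (auto simp: \<beta>_def)
    have bz: "\<beta> z = \<iota> ` C" by (simp add: \<beta>_def z_def)
    have f'old: "f' (Inl ` X) = ?\<Phi> (X \<times> {2})" for X
      unfolding f'_def block_reduct_def b gi by (auto simp: z_def)
    have f'new: "f' (Inl ` X \<union> {z}) = ?\<Phi> (X \<times> {2} \<union> C) - d" for X
    proof -
      have "\<Union> (\<beta> ` (Inl ` X \<union> {z})) = \<iota> ` (X \<times> {2} \<union> C)"
        unfolding image_Un Union_Un_distrib b by (simp add: bz)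
      then show ?thesis unfolding f'_def block_reduct_def by (simp add: gi)
    qed
    have "reducible (\<iota> ` (G \<times> {..<3})) g (Inl ` G \<union> {z}) \<beta> {z} (\<iota> ` C) d"
      unfolding reducible_def
    proof (intro conjI ballI)
      show "finite (Inl ` G \<union> {z})" using polymatroid_finite[OF fG] by simp
      show CU: "\<iota> ` C \<subseteq> \<iota> ` (G \<times> {..<3})"
        using A B by (intro image_mono) (auto simp: C_def)
      show "\<beta> e \<subseteq> \<iota> ` (G \<times> {..<3})" if "e \<in> Inl ` G \<union> {z}" for e
        using that CU bz by (auto simp: \<beta>_def)
      show "\<iota> ` C \<subseteq> \<beta> t" if "t \<in> {z}" for t using that bz by simp
      have E: "Inl ` G \<union> {z} - {z} = Inl ` G" by (auto simp: z_def)
      show "d \<le> g (\<Union> (\<beta> ` (Inl ` G \<union> {z} - {z})) \<union> \<iota> ` C) - g (\<Union> (\<beta> ` (Inl ` G \<union> {z} - {z})))"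
        unfolding E b image_Un[symmetric] gi
        using tensor_full_layer_gap[OF tensor A(2) B(2), of 0 1 2] tensor_layer[OF tensor, of G 2]
        by (simp add: C_def d_def)
    qed
    then have ext': "frac_mod_extendable_sum k (Inl ` G \<union> {z}) f'"
      by (rule frac_mod_extendable_block_reduct[OF g]) (simp add: f'_def)
    have old: "f' X = ?f X" if X: "X \<subseteq> Inl ` G" for X
    proof -
      obtain X0 where "X = Inl ` X0" "X0 \<subseteq> G" using X by (meson subset_imageE)
      then show ?thesis
        using f'old[of X0] tensor_layer[OF tensor, of X0 2] by (simp add: inj_vimage_image_eq)
    qed
    have "f' (A \<union> {z}) = ?f A"
      using f'new[of A0] tensor_two_blocks[OF tensor A(2) B(2), of 0 1 2]
      by (simp add: A C_def d_def inj_vimage_image_eq Un_assoc)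
    moreover have "f' (B \<union> {z}) = ?f B"
    proof -
      have "B0 \<times> {2} \<union> C = B0 \<times> {2} \<union> B0 \<times> {1} \<union> A0 \<times> {0}" by (auto simp: C_def)
      then show ?thesis
        using f'new[of B0] tensor_two_blocks[OF tensor B(2) A(2), of 1 0 2]
        by (simp add: B d_def inj_vimage_image_eq Un_commute)
    qed
    moreover have "f' {z} = ?f A + ?f B - ?f (A \<union> B)"
      using f'new[of "{}"] tensor_layers_modular[OF tensor A(2) B(2), of 0 1]
      by (simp add: A B C_def d_def inj_vimage_image_eq image_Un[symmetric])
    ultimately have "extension_step (Inl ` G) ?f A B (Inl ` G \<union> {z}) f'"
      unfolding extension_step_def
      using frac_mod_extendable_sum_polymatroid[OF ext'] old by (auto intro!: exI[of _ "{z}"])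
    with ext' show ?thesis by blast
  qed
  with fG' show ?thesis by (simp add: frac_mod_extendable_def)
qed

text \<open>
  A tower of \<open>k\<close> successive tensor products over an arbitrary \<open>f\<close>. In contrast to
  \<open>iterated_tensor_products\<close>, it adds stages at the bottom when \<open>k\<close> grows, and relabelling by
  \<open>push\<close> keeps all its stages on one type. An induction on \<open>k\<close> can thus pass from \<open>f\<close> to the first
  stage above it.
\<close>

primrec tensor_tower ::
  "nat \<Rightarrow> ('a \<times> 'b list) set \<Rightarrow> (('a \<times> 'b list) set \<Rightarrow> real) \<Rightarrow> 'b set \<Rightarrow> ('b set \<Rightarrow> real) \<Rightarrow> bool"
where
  "tensor_tower 0 G f S\<^sub>2 \<psi> \<longleftrightarrow> True"
| "tensor_tower (Suc k) G f S\<^sub>2 \<psi> \<longleftrightarrow>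
     (\<exists>\<Psi>. (\<lambda>X. \<Psi> (push ` X)) \<in> tensor_products G f S\<^sub>2 \<psi> \<and>
          tensor_tower k (push ` (G \<times> S\<^sub>2)) \<Psi> S\<^sub>2 \<psi>)"

lemma iterated_tensor_products_tower:
  assumes "iterated_tensor_products (j + k) S \<phi> S\<^sub>2 \<psi> \<noteq> {}"
  shows "\<exists>\<Phi> \<in> iterated_tensor_products j S \<phi> S\<^sub>2 \<psi>. tensor_tower k (iterated_ground j S S\<^sub>2) \<Phi> S\<^sub>2 \<psi>"
  using assms
proof (induction k arbitrary: j)
  case 0
  then show ?case by auto
next
  case (Suc k)
  then obtain \<Psi> where "\<Psi> \<in> iterated_tensor_products (Suc j) S \<phi> S\<^sub>2 \<psi>"
    and "tensor_tower k (iterated_ground (Suc j) S S\<^sub>2) \<Psi> S\<^sub>2 \<psi>"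
    using Suc.IH[of "Suc j"] by auto
  then show ?case by auto
qed

lemma frac_mod_extendable_if_tower:
  fixes G :: "('a \<times> nat list) set"
  assumes "polymatroid_function G f"
    and "tensor_tower k G f (uniform_ground 3) (uniform_rank 2)"
  shows "frac_mod_extendable k G f"
  using assms
proof (induction k arbitrary: G f)
  case 0
  have "polymatroid_function (Inl ` G) (\<lambda>X :: (('a \<times> nat list) + nat) set. f (Inl -` X))"
    by (rule polymatroid_image) (simp_all add: inj_vimage_image_eq 0)
  then show ?case by (simp add: frac_mod_extendable_def)
next
  case (Suc k)
  then obtain \<Psi> where
    tensor: "(\<lambda>X. \<Psi> (push ` X)) \<in> tensor_products G f (uniform_ground 3) (uniform_rank 2)"
    and tower: "tensor_tower k (push ` (G \<times> uniform_ground 3)) \<Psi> (uniform_ground 3) (uniform_rank 2)"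
    by auto
  have "polymatroid_function (push ` (G \<times> uniform_ground 3)) \<Psi>"
    using tensor inj_push by (intro polymatroid_image) (simp add: tensor_products_def)
  with tensor tower show ?case
    using Suc.IH frac_mod_extendable_if_tensor_product by blast
qed

text \<open>
  The bottom of the tower is a copy of \<open>\<phi>\<close> on \<open>S \<times> {[]}\<close>. It is brought back to \<open>S\<close> by a block
  reduction with singleton blocks and nothing marked.
\<close>

lemma frac_mod_extendable_if_tensor_compatible:
  fixes S :: "'a set"
  assumes "polymatroid_function S \<phi>"
    and "tensor_compatible k S \<phi> (uniform_ground 3) (uniform_rank 2)"
  shows "frac_mod_extendable k S \<phi>"
proof -
  let ?G = "S \<times> {[] :: nat list}"
  let ?g = "\<lambda>X :: (('a \<times> nat list) + nat) set. \<phi> (fst ` (Inl -` X))"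
  let ?\<beta> = "case_sum (\<lambda>s. {Inl (s, [])}) (\<lambda>_. {}) :: 'a + nat \<Rightarrow> (('a \<times> nat list) + nat) set"
  have tower: "tensor_tower k ?G (\<lambda>X. \<phi> (fst ` X)) (uniform_ground 3) (uniform_rank 2)"
    using iterated_tensor_products_tower[of 0 k S \<phi> "uniform_ground 3" "uniform_rank 2"] assms(2)
    by (simp add: tensor_compatible_def)
  have G: "?G = (\<lambda>s. (s, [])) ` S" by auto
  have "polymatroid_function ?G (\<lambda>X. \<phi> (fst ` X))"
    unfolding G by (rule polymatroid_image) (simp_all add: image_comp inj_def assms(1))
  then have "frac_mod_extendable k ?G (\<lambda>X. \<phi> (fst ` X))"
    using tower by (rule frac_mod_extendable_if_tower)
  then have ext: "frac_mod_extendable_sum k (Inl ` ?G) ?g"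
    by (simp add: frac_mod_extendable_def)
  have "frac_mod_extendable_sum k (Inl ` S) (\<lambda>X. \<phi> (Inl -` X))"
  proof (rule frac_mod_extendable_block_reduct[OF ext, where \<beta> = ?\<beta> and T = "{}" and C = "{}" and d = 0])
    show "reducible (Inl ` ?G) ?g (Inl ` S) ?\<beta> {} {} 0"
      using polymatroid_finite[OF assms(1)] by (auto simp: reducible_def)
  next
    fix X :: "('a + nat) set" assume "X \<subseteq> Inl ` S"
    then obtain X0 where X: "X = Inl ` X0" by (meson subset_imageE)
    have "fst ` (Inl -` (\<Union> (?\<beta> ` Inl ` X0))) = X0" by force
    then show "\<phi> (Inl -` X) = block_reduct ?g ?\<beta> {} 0 X"
      unfolding X block_reduct_def by (simp add: inj_vimage_image_eq)
  qed
  then show ?thesis by (simp add: frac_mod_extendable_def)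
qed

theorem corollary5p17:
  fixes S :: "'a set" and \<phi> :: "'a set \<Rightarrow> real"
  assumes "finite S"
    and "polymatroid_function S \<phi>"
    and "\<And>k::nat. k \<ge> 1 \<Longrightarrow> tensor_compatible k S \<phi> (uniform_ground 3) (uniform_rank 2)"
  shows "fully_frac_mod_extendable S \<phi>"
  unfolding fully_frac_mod_extendable_def
  using frac_mod_extendable_if_tensor_compatible[OF assms(2)] assms(3) by blast

end
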